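(* For every $n\ge3$ and every realizable bracelet $b\in\mathcal{B}_n$, the probability $\mathbb{P}(b)$ is a rational number.
   Context: Let $n\ge 3$ and let $P_1,\ldots,P_n$ be $n$ distinct points on the unit circle of the complex plane in counterclockwise cyclic order; let $L_i$ be the perpendicular bisector of $[P_i,P_{i+1}]$ (indices modulo $n$). Assume generic position: the lines $L_i$ are pairwise distinct, no $P_j$ lies on any $L_i$, and the point $1$ lies on no $L_i$. The lines divide the plane into $2n$ regions, numbered counterclockwise starting with the region containing $1$; the occupancy word is $(v_1,\ldots,v_{2n})\in\{0,1\}^{2n}$ where $v_i$ is the number of points $P_j$ in the $i$th region. A word is realizable if it is the occupancy word of some such generic collection. A bracelet is an equivalence class of words up to cyclic shifts and reversal; $\mathcal{B}_n$ is the set of realizable bracelets, i.e. classes of realizable words of length $2n$. Random model: select $n$ i.i.d. points uniformly at random on the unit circle (almost surely in generic position), label them in cyclic order, and consider the realizable word obtained. For $b\in\mathcal{B}_n$, $\mathbb{P}(b)$ is the probability that the equivalence class of this word is $b$. *)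

theory Defs
  imports "HOL-Probability.Probability"
begin

text \<open>Indices run over \<open>{..<n}\<close> (resp. \<open>{..<2 * n}\<close>) instead of \<open>1, \<dots>, n\<close> (resp. \<open>1, \<dots>, 2n\<close>).\<close>

definition ccw_cyclic :: "nat \<Rightarrow> (nat \<Rightarrow> complex) \<Rightarrow> bool" where
  "ccw_cyclic m P \<longleftrightarrow>
     (\<exists>\<theta>. (\<forall>i<m. P i = cis (\<theta> i)) \<and>
          (\<forall>i j. i < j \<and> j < m \<longrightarrow> \<theta> i < \<theta> j \<and> \<theta> j < \<theta> i + 2 * pi))"

definition perp_bisector :: "complex \<Rightarrow> complex \<Rightarrow> complex set" where
  "perp_bisector a b = {z. (z - midpoint a b) \<bullet> (b - a) = 0}"

definition bisector_line :: "nat \<Rightarrow> (nat \<Rightarrow> complex) \<Rightarrow> nat \<Rightarrow> complex set" where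
  "bisector_line n P i = perp_bisector (P i) (P (Suc i mod n))"

definition generic_collection :: "nat \<Rightarrow> (nat \<Rightarrow> complex) \<Rightarrow> bool" where
  "generic_collection n P \<longleftrightarrow>
     ccw_cyclic n P \<and>
     inj_on (bisector_line n P) {..<n} \<and>
     (\<forall>i<n. \<forall>j<n. P j \<notin> bisector_line n P i) \<and>
     (\<forall>i<n. 1 \<notin> bisector_line n P i)"

definition regions :: "nat \<Rightarrow> (nat \<Rightarrow> complex) \<Rightarrow> complex set set" where
  "regions n P = components (- (\<Union>i<n. bisector_line n P i))"

text \<open>All bisectors pass through \<open>0\<close>, so the regions are open sectors with apex \<open>0\<close>, each
  meeting the unit circle; their counterclockwise order is that of representatives on the
  circle and does not depend on the choice of these.\<close>

definition ccw_numbering :: "nat \<Rightarrow> (nat \<Rightarrow> complex) \<Rightarrow> (nat \<Rightarrow> complex set) \<Rightarrow> bool" where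
  "ccw_numbering n P R \<longleftrightarrow>
     bij_betw R {..<2 * n} (regions n P) \<and>
     1 \<in> R 0 \<and>
     (\<exists>Q. (\<forall>k<2 * n. Q k \<in> R k) \<and> ccw_cyclic (2 * n) Q)"

text \<open>For a generic collection there is exactly one occupancy word, and its entries are at
  most \<open>1\<close>: consecutive points are separated by their bisector.\<close>

definition is_occupancy_word :: "nat \<Rightarrow> (nat \<Rightarrow> complex) \<Rightarrow> nat list \<Rightarrow> bool" where
  "is_occupancy_word n P w \<longleftrightarrow>
     (\<exists>R. ccw_numbering n P R \<and>
          w = map (\<lambda>k. card {j. j < n \<and> P j \<in> R k}) [0..<2 * n])"

definition realizable :: "nat \<Rightarrow> nat list \<Rightarrow> bool" where
  "realizable n w \<longleftrightarrow> (\<exists>P. generic_collection n P \<and> is_occupancy_word n P w)"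

definition bracelet_rel :: "(nat list \<times> nat list) set" where
  "bracelet_rel = {(v, w). \<exists>k. w = rotate k v \<or> w = rotate k (rev v)}"

lemma equiv_bracelet_rel: "equiv UNIV bracelet_rel"
proof (rule equivI)
  have inv: "\<exists>m. rotate m (rotate k v) = v" for k and v :: "nat list"
  proof -
    have "length v * k - k + k = length v * k" if "v \<noteq> []"
      using that by (cases v) simp_all
    then have "rotate (length v * k - k) (rotate k v) = v" if "v \<noteq> []"
      using that by (simp add: rotate_rotate rotate_id)
    then show ?thesis by (cases "v = []") auto
  qed
  have rev_rot: "\<exists>m. rev (rotate k v) = rotate m (rev v)" for k and v :: "nat list"
  proof -
    obtain m where "rotate m (rotate k v) = v" using inv by blast
    then obtain c where "rev v = rotate c (rev (rotate k v))"
      using rotate_rev[of m "rev (rotate k v)"] by (metis rev_rev_ident)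
    then show ?thesis using inv[of c "rev (rotate k v)"] by metis
  qed
  show "bracelet_rel \<subseteq> UNIV \<times> UNIV" by simp
  show "refl bracelet_rel"
    unfolding refl_on_def bracelet_rel_def by (auto intro: exI[of _ 0])
  show "sym bracelet_rel"
  proof (rule symI)
    fix v w :: "nat list"
    assume "(v, w) \<in> bracelet_rel"
    then obtain k where "w = rotate k v \<or> w = rotate k (rev v)"
      by (auto simp: bracelet_rel_def)
    then show "(w, v) \<in> bracelet_rel"
    proof
      assume "w = rotate k v"
      then have "\<exists>l. v = rotate l w" using inv[of k v] by metis
      then show ?thesis unfolding bracelet_rel_def by fast
    next
      assume "w = rotate k (rev v)"
      then obtain m where "rev w = rotate m v"
        using rev_rot[of k "rev v"] by auto
      then have "\<exists>l. v = rotate l (rev w)" using inv[of m v] by metis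
      then show ?thesis unfolding bracelet_rel_def by fast
    qed
  qed
  show "trans bracelet_rel"
  proof (rule transI)
    fix u v w :: "nat list"
    assume "(u, v) \<in> bracelet_rel" "(v, w) \<in> bracelet_rel"
    then obtain k l where k: "v = rotate k u \<or> v = rotate k (rev u)"
      and l: "w = rotate l v \<or> w = rotate l (rev v)"
      by (auto simp: bracelet_rel_def)
    from k obtain m where "rev v = rotate m (rev u) \<or> rev v = rotate m u"
      using rev_rot[of k u] rev_rot[of k "rev u"] by auto
    with k l show "(u, w) \<in> bracelet_rel"
      by (auto simp: bracelet_rel_def rotate_rotate)
  qed
qed

definition realizable_bracelets :: "nat \<Rightarrow> nat list set set" where
  "realizable_bracelets n = {w. realizable n w} // bracelet_rel"

definition uniform_circle :: "complex measure" where
  "uniform_circle = distr (uniform_measure lborel {0..<2 * pi}) borel cis"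

text \<open>The i.i.d. points \<open>X 0, \<dots>, X (n - 1)\<close> are unordered; \<open>\<sigma>\<close> labels them in counterclockwise
  cyclic order. The labelling is unique up to a cyclic shift, which changes neither the set of
  bisectors nor the occupancy word.\<close>

definition bracelet_prob :: "nat \<Rightarrow> nat list set \<Rightarrow> real" where
  "bracelet_prob n b =
     \<P>(X in (\<Pi>\<^sub>M i\<in>{..<n}. uniform_circle).
        \<exists>\<sigma> w. \<sigma> permutes {..<n} \<and> generic_collection n (X \<circ> \<sigma>) \<and>
              is_occupancy_word n (X \<circ> \<sigma>) w \<and> bracelet_rel `` {w} = b)"

end

theory Submission
  imports Defs
begin

text \<open>
  Write the points as \<open>cis (2 * pi * x i)\<close> with \<open>x i \<in> {0..<1}\<close>. The bisectors meet the circle at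
  the angles \<open>(x i + x j + m) / 2\<close> with \<open>m\<close> an integer. If two configurations order these angles, the
  points and \<open>1\<close> in the same way, then a homeomorphism of the circle fixing \<open>1\<close> matches them, and its
  radial extension to the plane carries points, bisectors and regions of one configuration to
  those of the other. So the event depends only on the signs of finitely many rational affine
  forms in \<open>x\<close>, and its indicator is a polynomial in the indicators of rational open half-spaces.
  The algebra generated by such indicators and the rational affine forms is stable under
  integration of one coordinate over \<open>{0..<1}\<close>; after integrating all coordinates only a rational
  constant remains.
\<close>

subsection \<open>Rational piecewise polynomial functions\<close>

text \<open>Elements are functions of the whole point \<open>x\<close> but read only the coordinates
  in \<open>I\<close>. Thus shrinking \<open>I\<close> records which variables have been integrated
  out, and \<open>I = {}\<close> leaves only rational constants.\<close>

definition rat_affine :: "'i set \<Rightarrow> (('i \<Rightarrow> real) \<Rightarrow> real) set" where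
  "rat_affine I = {\<lambda>x. c + (\<Sum>i\<in>I. a i * x i) | a c. c \<in> \<rat> \<and> (\<forall>i. a i \<in> \<rat>)}"

lemma rat_affine_const: "c \<in> \<rat> \<Longrightarrow> (\<lambda>x. c) \<in> rat_affine I"
  unfolding rat_affine_def by (auto intro!: exI[of _ "\<lambda>_. 0"] exI[of _ c])

lemma rat_affine_coord:
  assumes "finite I" "i \<in> I"
  shows "(\<lambda>x. x i) \<in> rat_affine I"
  unfolding rat_affine_def
  by (auto intro!: exI[of _ "\<lambda>j. of_bool (j = i)"] exI[of _ 0] simp: fun_eq_iff assms of_bool_def
      if_distrib[of "\<lambda>x. x * _"] cong: if_cong)

lemma rat_affine_add:
  assumes "l \<in> rat_affine I" "m \<in> rat_affine I"
  shows "(\<lambda>x. l x + m x) \<in> rat_affine I"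
proof -
  obtain a c a' c' where "c \<in> \<rat>" "\<forall>i. a i \<in> \<rat>" "c' \<in> \<rat>" "\<forall>i. a' i \<in> \<rat>"
    and "l = (\<lambda>x. c + (\<Sum>i\<in>I. a i * x i))" "m = (\<lambda>x. c' + (\<Sum>i\<in>I. a' i * x i))"
    using assms unfolding rat_affine_def by auto
  then show ?thesis
    unfolding rat_affine_def
    by (auto intro!: exI[of _ "\<lambda>i. a i + a' i"] exI[of _ "c + c'"]
        simp: fun_eq_iff sum.distrib distrib_right)
qed

lemma rat_affine_scale:
  assumes "l \<in> rat_affine I" "r \<in> \<rat>"
  shows "(\<lambda>x. r * l x) \<in> rat_affine I"
proof -
  obtain a c where "c \<in> \<rat>" "\<forall>i. a i \<in> \<rat>" "l = (\<lambda>x. c + (\<Sum>i\<in>I. a i * x i))"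
    using assms unfolding rat_affine_def by auto
  then show ?thesis
    unfolding rat_affine_def using \<open>r \<in> \<rat>\<close>
    by (auto intro!: exI[of _ "\<lambda>i. r * a i"] exI[of _ "r * c"]
        simp: fun_eq_iff sum_distrib_left distrib_left mult_ac)
qed

lemma rat_affine_diff:
  assumes "l \<in> rat_affine I" "m \<in> rat_affine I"
  shows "(\<lambda>x. l x - m x) \<in> rat_affine I"
  using rat_affine_add[OF assms(1) rat_affine_scale[OF assms(2), of "-1"]] by simp

text \<open>Strict half-spaces suffice as generators: products give conjunctions and
  \<open>1 - f\<close> gives negations, so every Boolean combination of rational affine comparisons
  has its indicator here.\<close>

inductive_set rat_pp :: "'i set \<Rightarrow> (('i \<Rightarrow> real) \<Rightarrow> real) set" for I where
  affine: "l \<in> rat_affine I \<Longrightarrow> l \<in> rat_pp I"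
| pos: "l \<in> rat_affine I \<Longrightarrow> (\<lambda>x. of_bool (l x > 0)) \<in> rat_pp I"
| add: "f \<in> rat_pp I \<Longrightarrow> g \<in> rat_pp I \<Longrightarrow> (\<lambda>x. f x + g x) \<in> rat_pp I"
| mult: "f \<in> rat_pp I \<Longrightarrow> g \<in> rat_pp I \<Longrightarrow> (\<lambda>x. f x * g x) \<in> rat_pp I"

lemma rat_pp_const: "c \<in> \<rat> \<Longrightarrow> (\<lambda>x. c) \<in> rat_pp I"
  by (intro rat_pp.affine rat_affine_const)

lemma rat_pp_scale: "r \<in> \<rat> \<Longrightarrow> f \<in> rat_pp I \<Longrightarrow> (\<lambda>x. r * f x) \<in> rat_pp I"
  by (intro rat_pp.mult rat_pp_const)

lemma rat_pp_diff: "f \<in> rat_pp I \<Longrightarrow> g \<in> rat_pp I \<Longrightarrow> (\<lambda>x. f x - g x) \<in> rat_pp I"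
  using rat_pp.add[OF _ rat_pp_scale[of "-1"]] by fastforce

lemma rat_pp_power: "f \<in> rat_pp I \<Longrightarrow> (\<lambda>x. f x ^ k) \<in> rat_pp I"
  by (induction k) (auto intro: rat_pp_const rat_pp.mult)

lemma rat_pp_less:
  assumes "l \<in> rat_affine I" "m \<in> rat_affine I"
  shows "(\<lambda>x. of_bool (l x < m x)) \<in> rat_pp I"
  using rat_pp.pos[OF rat_affine_diff[OF assms(2,1)]] by simp

lemma rat_pp_not:
  assumes "(\<lambda>x. of_bool (P x)) \<in> rat_pp I"
  shows "(\<lambda>x. of_bool (\<not> P x)) \<in> rat_pp I"
  using rat_pp_diff[OF rat_pp_const[of 1] assms] by (simp add: of_bool_not_iff)

lemma rat_pp_conj:
  assumes "(\<lambda>x. of_bool (P x)) \<in> rat_pp I" "(\<lambda>x. of_bool (Q x)) \<in> rat_pp I"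
  shows "(\<lambda>x. of_bool (P x \<and> Q x)) \<in> rat_pp I"
  using rat_pp.mult[OF assms] by (simp add: of_bool_conj)

lemma rat_pp_eq:
  assumes "l \<in> rat_affine I" "m \<in> rat_affine I"
  shows "(\<lambda>x. of_bool (l x = m x)) \<in> rat_pp I"
proof -
  have "l x = m x \<longleftrightarrow> \<not> l x < m x \<and> \<not> m x < l x" for x by auto
  then show ?thesis
    using rat_pp_conj[OF rat_pp_not[OF rat_pp_less[OF assms]]
        rat_pp_not[OF rat_pp_less[OF assms(2,1)]]] by simp
qed

lemma rat_pp_ball:
  assumes "finite T" "\<And>Q. Q \<in> T \<Longrightarrow> (\<lambda>x. of_bool (P Q x)) \<in> rat_pp I"
  shows "(\<lambda>x. of_bool (\<forall>Q\<in>T. P Q x)) \<in> rat_pp I"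
  using assms by (induction T) (auto intro: rat_pp_conj rat_pp_const)

lemma rat_pp_bex:
  assumes "finite T" "\<And>Q. Q \<in> T \<Longrightarrow> (\<lambda>x. of_bool (P Q x)) \<in> rat_pp I"
  shows "(\<lambda>x. of_bool (\<exists>Q\<in>T. P Q x)) \<in> rat_pp I"
proof -
  have "(\<exists>Q\<in>T. P Q x) \<longleftrightarrow> \<not> (\<forall>Q\<in>T. \<not> P Q x)" for x by blast
  then show ?thesis
    by (simp only:) (intro rat_pp_not rat_pp_ball assms)
qed

text \<open>The truth pattern of \<open>x\<close> is the set of tests in \<open>T\<close> that it
  passes, so there are finitely many patterns. \<open>G\<close> says that \<open>x\<close> has the
  pattern of some point of \<open>D\<close> satisfying \<open>F\<close>; on \<open>D\<close> this is
  \<open>F\<close> itself, by invariance.\<close>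

lemma rat_pp_finitely_determined:
  assumes "finite T" "\<And>Q. Q \<in> T \<Longrightarrow> (\<lambda>x. of_bool (P Q x)) \<in> rat_pp I"
    and F: "\<And>x y. x \<in> D \<Longrightarrow> y \<in> D \<Longrightarrow> (\<And>Q. Q \<in> T \<Longrightarrow> P Q x \<longleftrightarrow> P Q y) \<Longrightarrow> F x \<Longrightarrow> F y"
  shows "\<exists>G. (\<lambda>x. of_bool (G x)) \<in> rat_pp I \<and> (\<forall>x\<in>D. F x \<longleftrightarrow> G x)"
proof (intro exI conjI ballI)
  define cells where "cells = {{Q \<in> T. P Q y} | y. y \<in> D \<and> F y}"
  have "cells \<subseteq> Pow T" by (auto simp: cells_def)
  then have "finite cells" using assms(1) finite_subset by blast
  moreover have "(\<lambda>x. of_bool (P Q x \<longleftrightarrow> Q \<in> C)) \<in> rat_pp I" if "Q \<in> T" for Q C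
    using assms(2)[OF that] rat_pp_not[OF assms(2)[OF that]] by (cases "Q \<in> C") auto
  ultimately show "(\<lambda>x. of_bool (\<exists>C\<in>cells. \<forall>Q\<in>T. P Q x \<longleftrightarrow> Q \<in> C)) \<in> rat_pp I"
    using assms(1) by (intro rat_pp_bex rat_pp_ball)
  fix x assume "x \<in> D"
  show "F x \<longleftrightarrow> (\<exists>C\<in>cells. \<forall>Q\<in>T. P Q x \<longleftrightarrow> Q \<in> C)"
  proof
    assume "F x"
    then show "\<exists>C\<in>cells. \<forall>Q\<in>T. P Q x \<longleftrightarrow> Q \<in> C"
      using \<open>x \<in> D\<close> by (intro bexI[of _ "{Q \<in> T. P Q x}"]) (auto simp: cells_def)
  next
    assume "\<exists>C\<in>cells. \<forall>Q\<in>T. P Q x \<longleftrightarrow> Q \<in> C"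
    then obtain y where "y \<in> D" "F y" "\<forall>Q\<in>T. P Q x \<longleftrightarrow> P Q y"
      by (auto simp: cells_def)
    then show "F x" using F[of y x] \<open>x \<in> D\<close> by blast
  qed
qed

lemma rat_affine_update:
  assumes "l \<in> rat_affine I" "i \<notin> I"
  shows "l (x(i := t)) = l x"
proof -
  have "(\<Sum>j\<in>I. a j * (x(i := t)) j) = (\<Sum>j\<in>I. a j * x j)" for a
    using assms(2) by (intro sum.cong) auto
  then show ?thesis using assms(1) unfolding rat_affine_def by auto
qed

text \<open>This makes the coefficients and thresholds of a slice constants when coordinate
  \<open>i\<close> is integrated.\<close>

lemma rat_pp_update: "f \<in> rat_pp I \<Longrightarrow> i \<notin> I \<Longrightarrow> f (x(i := t)) = f x"
  by (induction rule: rat_pp.induct) (simp_all add: rat_affine_update)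

text \<open>Elements of \<open>rat_pp (insert i I)\<close>, viewed as functions of the coordinate \<open>i\<close> alone, are sums of
  monomials cut off below one threshold. Products stay in this class because two thresholds can
  be compared by indicators in \<open>rat_pp I\<close>; so no minima or maxima of thresholds occur.\<close>

inductive_set rat_slice :: "'i \<Rightarrow> 'i set \<Rightarrow> (('i \<Rightarrow> real) \<Rightarrow> real) set" for i I where
  gen: "c \<in> rat_pp I \<Longrightarrow> m \<in> rat_affine I \<Longrightarrow> R \<in> {(<), (\<le>), \<lambda>_ _. True} \<Longrightarrow>
    (\<lambda>x. c x * x i ^ k * of_bool (R (m x) (x i))) \<in> rat_slice i I"
| add: "f \<in> rat_slice i I \<Longrightarrow> g \<in> rat_slice i I \<Longrightarrow> (\<lambda>x. f x + g x) \<in> rat_slice i I"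

lemma rat_slice_monom: "c \<in> rat_pp I \<Longrightarrow> (\<lambda>x. c x * x i ^ k) \<in> rat_slice i I"
  using rat_slice.gen[of c I "\<lambda>_. 0" "\<lambda>_ _. True" i k] by (simp add: rat_affine_const)

text \<open>Of two cutoffs the one with the larger threshold implies the other. Splitting by the
  order of the thresholds leaves one cutoff per term, and the splitting indicators go into the
  coefficient.\<close>

lemma rat_slice_mult_gen:
  assumes "c \<in> rat_pp I" "m \<in> rat_affine I" "R \<in> {(<), (\<le>), \<lambda>_ _. True}"
    and "c' \<in> rat_pp I" "m' \<in> rat_affine I" "R' \<in> {(<), (\<le>), \<lambda>_ _. True}"
  shows "(\<lambda>x. (c x * x i ^ k * of_bool (R (m x) (x i))) *
    (c' x * x i ^ k' * of_bool (R' (m' x) (x i)))) \<in> rat_slice i I"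
proof -
  consider "R = (\<lambda>_ _. True)" | "R' = (\<lambda>_ _. True)" | "R \<in> {(<), (\<le>)}" "R' \<in> {(<), (\<le>)}"
    using assms by blast
  then show ?thesis
  proof cases
    case 1
    then show ?thesis
      using rat_slice.gen[OF rat_pp.mult[OF assms(1,4)] assms(5,6), of i "k + k'"]
      by (simp add: power_add mult_ac)
  next
    case 2
    then show ?thesis
      using rat_slice.gen[OF rat_pp.mult[OF assms(1,4)] assms(2,3), of i "k + k'"]
      by (simp add: power_add mult_ac)
  next
    case 3
    \<comment> \<open>At equal thresholds the conjunction is strict as soon as one of the two
      relations is.\<close>
    define S :: "real \<Rightarrow> real \<Rightarrow> bool" where "S = (if R = (<) then (<) else R')"
    have S: "S \<in> {(<), (\<le>), \<lambda>_ _. True}" using 3 by (auto simp: S_def)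
    have S_iff: "S a t \<longleftrightarrow> R a t \<and> R' a t" for a t
      using 3 by (auto simp: S_def)
    have *: "of_bool (R a t) * of_bool (R' a' t) = of_bool (a < a') * of_bool (R' a' t) +
        of_bool (a' < a) * of_bool (R a t) + of_bool (a = a') * (of_bool (S a t) :: real)"
      for a a' t :: real
      using 3 by (cases a a' rule: linorder_cases) (auto simp: S_iff)
    let ?c = "\<lambda>x. c x * c' x"
    have "(\<lambda>x. (((?c x * of_bool (m x < m' x)) * x i ^ (k + k') * of_bool (R' (m' x) (x i))) +
       ((?c x * of_bool (m' x < m x)) * x i ^ (k + k') * of_bool (R (m x) (x i)))) +
       (?c x * of_bool (m x = m' x)) * x i ^ (k + k') * of_bool (S (m x) (x i))) \<in> rat_slice i I"
      using assms S by (intro rat_slice.add rat_slice.gen rat_pp.mult rat_pp_less rat_pp_eq)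
    also have "(\<lambda>x. (((?c x * of_bool (m x < m' x)) * x i ^ (k + k') * of_bool (R' (m' x) (x i))) +
       ((?c x * of_bool (m' x < m x)) * x i ^ (k + k') * of_bool (R (m x) (x i)))) +
       (?c x * of_bool (m x = m' x)) * x i ^ (k + k') * of_bool (S (m x) (x i))) =
       (\<lambda>x. (?c x * x i ^ (k + k')) * (of_bool (R (m x) (x i)) * of_bool (R' (m' x) (x i))))"
      unfolding * by (simp only: distrib_left mult_ac)
    finally show ?thesis by (simp add: power_add mult_ac)
  qed
qed

lemma rat_slice_mult:
  assumes "f \<in> rat_slice i I" "g \<in> rat_slice i I"
  shows "(\<lambda>x. f x * g x) \<in> rat_slice i I"
  using assms(1)
proof induction
  case (gen c m R k)
  from assms(2) show ?case
  proof induction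
    case (gen c' m' R' k')
    then show ?case using \<open>c \<in> _\<close> \<open>m \<in> _\<close> \<open>R \<in> _\<close> by (intro rat_slice_mult_gen)
  next
    case (add g h)
    then show ?case by (simp only: distrib_left rat_slice.add)
  qed
next
  case (add f f')
  then show ?case by (simp only: distrib_right rat_slice.add)
qed

text \<open>An affine form is \<open>r * x i + m x\<close> with \<open>m\<close> free of
  \<open>i\<close>. If \<open>r\<close> is nonzero, its sign change in \<open>x i\<close> occurs at
  the threshold \<open>- m x / r\<close>, which is again rational affine in the remaining
  coordinates.\<close>

lemma rat_pp_insert_slice:
  assumes "f \<in> rat_pp (insert i I)" "finite I" "i \<notin> I"
  shows "f \<in> rat_slice i I"
proof -
  have split: "\<exists>r m. r \<in> \<rat> \<and> m \<in> rat_affine I \<and> l = (\<lambda>x. r * x i + m x)"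
    if "l \<in> rat_affine (insert i I)" for l
  proof -
    obtain a c where "c \<in> \<rat>" "\<forall>i. a i \<in> \<rat>" and l: "l = (\<lambda>x. c + (\<Sum>i\<in>insert i I. a i * x i))"
      using \<open>l \<in> _\<close> unfolding rat_affine_def by auto
    then have "(\<lambda>x. c + (\<Sum>i\<in>I. a i * x i)) \<in> rat_affine I"
      unfolding rat_affine_def by auto
    moreover have "l = (\<lambda>x. a i * x i + (c + (\<Sum>i\<in>I. a i * x i)))"
      using assms by (simp add: l fun_eq_iff)
    ultimately show ?thesis using \<open>\<forall>i. a i \<in> \<rat>\<close> by blast
  qed
  show ?thesis
    using assms(1)
  proof induction
    case (affine l)
    then obtain r m where r: "r \<in> \<rat>" and m: "m \<in> rat_affine I"
      and l: "l = (\<lambda>x. r * x i + m x)"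
      using split by blast
    have "(\<lambda>x. r * x i ^ 1 + m x * x i ^ 0) \<in> rat_slice i I"
      using r m by (intro rat_slice.add rat_slice_monom rat_pp_const rat_pp.affine)
    then show ?case by (simp add: l)
  next
    case (pos l)
    then obtain r m where r: "r \<in> \<rat>" and m: "m \<in> rat_affine I"
      and l: "l = (\<lambda>x. r * x i + m x)"
      using split by blast
    have m': "(\<lambda>x. - (1 / r) * m x) \<in> rat_affine I"
      using r m by (intro rat_affine_scale) auto
    consider "r = 0" | "r > 0" | "r < 0" by linarith
    then show ?case
    proof cases
      case 1
      then show ?thesis
        using rat_slice_monom[OF rat_pp.pos[OF m], of i 0] by (simp add: l)
    next
      case 2
      have "(l x > 0) = (- (1 / r) * m x < x i)" for x
        using 2 by (auto simp: l field_simps)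
      then show ?thesis
        using rat_slice.gen[OF rat_pp_const[of 1] m', of "(<)" i 0] by simp
    next
      case 3
      \<comment> \<open>For negative \<open>r\<close> positivity holds below the threshold, so it is
        one minus a weak cutoff. This is why slices admit \<open>(\<le>)\<close> besides
        \<open>(<)\<close>.\<close>
      have *: "of_bool (l x > 0) = 1 * x i ^ 0 + (-1) * x i ^ 0 * of_bool (- (1 / r) * m x \<le> x i)" for x
        using 3 by (auto simp: l field_simps)
      show ?thesis
        unfolding * using m'
        by (intro rat_slice.add rat_slice_monom rat_slice.gen rat_pp_const) auto
    qed
  next
    case (add f g)
    then show ?case by (intro rat_slice.add)
  next
    case (mult f g)
    then show ?case by (intro rat_slice_mult)
  qed
qed

section \<open>Integration over the unit interval and the unit cube\<close>

abbreviation unif01 :: "real measure" where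
  "unif01 \<equiv> uniform_measure lborel {0..<1}"

lemma unif01_density: "unif01 = density lborel (\<lambda>t. ennreal (indicator {0..<1} t))"
  unfolding uniform_measure_def by (intro density_cong) (auto simp: indicator_def divide_ennreal_def)

lemma prob_space_unif01: "prob_space unif01"
  by (intro prob_space_uniform_measure) auto

text \<open>Up to null sets the integrand lives on \<open>{u..1}\<close>, where \<open>u\<close> is
  the threshold clamped to the unit interval; the fundamental theorem of calculus then applies.
  Strict and weak cutoffs give the same integral.\<close>

lemma has_bochner_integral_unif01_step:
  assumes "R \<in> {(<), (\<le>)}"
  shows "has_bochner_integral unif01 (\<lambda>t. t ^ k * of_bool (R m t))
    ((1 - (max 0 (min 1 m)) ^ Suc k) / Suc k)"
proof -
  define u where "u = max 0 (min 1 m)"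
  have [measurable]: "(\<lambda>t. t ^ k * of_bool (R m t)) \<in> borel_measurable borel"
    using assms by auto
  have "u \<le> 1" by (simp add: u_def)
  have "((\<lambda>t. t ^ Suc k / Suc k) has_real_derivative t ^ k) (at t)" for t :: real
    by (intro derivative_eq_intros) auto
  then have power: "has_bochner_integral lborel (\<lambda>t. t ^ k * indicator {u..1} t)
      ((1 - u ^ Suc k) / Suc k)"
    using has_bochner_integral_FTC_Icc_real[OF \<open>u \<le> 1\<close>,
        of "\<lambda>t. t ^ Suc k / Suc k" "\<lambda>t. t ^ k"]
    by (simp add: diff_divide_distrib)
  \<comment> \<open>The two integrands can differ only at the ends of the interval and at the
    threshold.\<close>
  have "AE t in lborel. t \<noteq> 0 \<and> t \<noteq> 1 \<and> t \<noteq> m"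
    by (intro AE_conjI AE_lborel_singleton)
  then have "AE t in lborel. t ^ k * indicator {u..1} t =
      indicator {0..<1} t *\<^sub>R (t ^ k * of_bool (R m t))"
    by eventually_elim (use assms in \<open>auto simp: u_def indicator_def\<close>)
  then have "has_bochner_integral lborel (\<lambda>t. indicator {0..<1} t *\<^sub>R (t ^ k * of_bool (R m t)))
      ((1 - u ^ Suc k) / Suc k)"
    using power by (subst has_bochner_integral_cong_AE[symmetric]) auto
  then show ?thesis
    unfolding unif01_density u_def by (intro has_bochner_integral_density) auto
qed

lemma has_bochner_integral_unif01_power:
  "has_bochner_integral unif01 (\<lambda>t. t ^ k) (1 / Suc k)"
proof -
  have "AE t in unif01. t ^ k = t ^ k * of_bool (0 \<le> t)"
    unfolding uniform_measure_def by (subst AE_density) auto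
  then show ?thesis
    using has_bochner_integral_unif01_step[of "(\<le>)" k 0]
    by (subst has_bochner_integral_cong_AE) auto
qed

text \<open>Linearity reduces this to one truncated monomial, whose integral is a polynomial in the
  clamped threshold. Clamping is expressible by indicators, so the result stays in
  \<open>rat_pp I\<close>. The identity holds at every \<open>x\<close>, which allows the
  integration to be iterated.\<close>

lemma rat_pp_integrate_coord:
  assumes "f \<in> rat_pp (insert i I)" "finite I" "i \<notin> I"
  shows "\<exists>g\<in>rat_pp I. \<forall>x. has_bochner_integral unif01 (\<lambda>t. f (x(i := t))) (g x)"
  using rat_pp_insert_slice[OF assms]
proof induction
  case (gen c m R k)
  note upd = rat_pp_update[OF gen(1) \<open>i \<notin> I\<close>] rat_affine_update[OF gen(2) \<open>i \<notin> I\<close>]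
  have k: "1 / real (Suc k) \<in> \<rat>" by auto
  show ?case
  proof (cases "R \<in> {(<), (\<le>)}")
    case True
    \<comment> \<open>the threshold clamped to the unit interval\<close>
    let ?v = "\<lambda>x. of_bool (0 < m x) * of_bool (m x < 1) * m x + of_bool (\<not> m x < 1)"
    have v: "?v x = max 0 (min 1 (m x))" for x by auto
    let ?g = "\<lambda>x. c x * (1 / real (Suc k) * (1 - ?v x ^ Suc k))"
    have "?g \<in> rat_pp I"
      using gen(1,2) k
      by (intro rat_pp.mult[OF gen(1)] rat_pp.mult rat_pp.add rat_pp_scale rat_pp_diff rat_pp_power
          rat_pp_not rat_pp_const rat_pp_less rat_affine_const rat_pp.affine[of m] Rats_0 Rats_1)
    moreover have "has_bochner_integral unif01 (\<lambda>t. c x * (t ^ k * of_bool (R (m x) t))) (?g x)" for x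
      using has_bochner_integral_mult_right[OF has_bochner_integral_unif01_step[OF True, of k "m x"],
          of "c x"]
      unfolding v by simp
    ultimately show ?thesis
      by (intro bexI[of _ ?g] allI) (simp_all only: upd fun_upd_same mult.assoc)
  next
    case False
    then have R: "R = (\<lambda>_ _. True)" using gen by blast
    have "(\<lambda>x. c x * (1 / real (Suc k))) \<in> rat_pp I"
      using gen(1) k by (intro rat_pp.mult rat_pp_const)
    moreover have "has_bochner_integral unif01 (\<lambda>t. c x * t ^ k) (c x * (1 / real (Suc k)))" for x
      by (intro has_bochner_integral_mult_right has_bochner_integral_unif01_power)
    ultimately show ?thesis
      by (intro bexI[of _ "\<lambda>x. c x * (1 / real (Suc k))"] allI)
        (simp_all only: upd fun_upd_same R of_bool_eq mult_1_right)
  qed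
next
  case (add f g)
  then obtain f' g' where "f' \<in> rat_pp I" "g' \<in> rat_pp I"
    "\<And>x. has_bochner_integral unif01 (\<lambda>t. f (x(i := t))) (f' x)"
    "\<And>x. has_bochner_integral unif01 (\<lambda>t. g (x(i := t))) (g' x)"
    by blast
  then show ?case
    by (intro bexI[of _ "\<lambda>x. f' x + g' x"] allI has_bochner_integral_add rat_pp.add)
qed

lemma rat_pp_measurable:
  assumes "f \<in> rat_pp I"
  shows "f \<in> borel_measurable (PiM I (\<lambda>_. unif01))"
proof -
  have comp[measurable]: "(\<lambda>x. x i) \<in> borel_measurable (PiM I (\<lambda>_. unif01))" if "i \<in> I" for i
    using measurable_component_singleton[OF that, of "\<lambda>_. unif01"]
    by (simp cong: measurable_cong_sets)
  have [measurable]: "l \<in> borel_measurable (PiM I (\<lambda>_. unif01))" if "l \<in> rat_affine I" for l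
    using that unfolding rat_affine_def by auto
  from assms show ?thesis
    by induction simp_all
qed

text \<open>Boundedness on the cube gives integrability, since almost every point of the product
  space has its coordinates there.\<close>

lemma rat_pp_bounded:
  assumes "f \<in> rat_pp I"
  shows "\<exists>B. \<forall>x. (\<forall>i\<in>I. x i \<in> {0..<1}) \<longrightarrow> \<bar>f x\<bar> \<le> B"
  using assms
proof induction
  case (affine l)
  then obtain a c where l: "l = (\<lambda>x. c + (\<Sum>i\<in>I. a i * x i))"
    unfolding rat_affine_def by auto
  have "\<bar>l x\<bar> \<le> \<bar>c\<bar> + (\<Sum>i\<in>I. \<bar>a i\<bar>)" if "\<forall>i\<in>I. x i \<in> {0..<1}" for x
  proof -
    have "\<bar>\<Sum>i\<in>I. a i * x i\<bar> \<le> (\<Sum>i\<in>I. \<bar>a i\<bar>)"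
      using that by (intro order.trans[OF sum_abs] sum_mono)
        (auto simp: abs_mult intro!: mult_left_le)
    then show ?thesis unfolding l by linarith
  qed
  then show ?case by blast
next
  case (pos l)
  then show ?case by (intro exI[of _ 1]) auto
next
  case (add f g)
  then obtain B B' where *: "\<And>x. (\<forall>i\<in>I. x i \<in> {0..<1}) \<Longrightarrow> \<bar>f x\<bar> \<le> B"
    "\<And>x. (\<forall>i\<in>I. x i \<in> {0..<1}) \<Longrightarrow> \<bar>g x\<bar> \<le> B'" by blast
  show ?case
  proof (intro exI[of _ "B + B'"] allI impI)
    fix x :: "'a \<Rightarrow> real" assume "\<forall>i\<in>I. x i \<in> {0..<1}"
    from *[OF this] show "\<bar>f x + g x\<bar> \<le> B + B'" by linarith
  qed
next
  case (mult f g)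
  then obtain B B' where *: "\<And>x. (\<forall>i\<in>I. x i \<in> {0..<1}) \<Longrightarrow> \<bar>f x\<bar> \<le> B"
    "\<And>x. (\<forall>i\<in>I. x i \<in> {0..<1}) \<Longrightarrow> \<bar>g x\<bar> \<le> B'" by blast
  show ?case
  proof (intro exI[of _ "B * B'"] allI impI)
    fix x :: "'a \<Rightarrow> real" assume "\<forall>i\<in>I. x i \<in> {0..<1}"
    from *[OF this] show "\<bar>f x * g x\<bar> \<le> B * B'"
      by (auto simp: abs_mult intro!: mult_mono)
  qed
qed

lemma prob_space_PiM_unif01: "prob_space (PiM I (\<lambda>_. unif01))"
  by (intro prob_space_PiM prob_space_unif01)

lemma AE_PiM_unif01:
  assumes "finite I"
  shows "AE x in PiM I (\<lambda>_. unif01). \<forall>i\<in>I. x i \<in> {0..<1}"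
proof (intro AE_finite_allI[OF assms] AE_PiM_component prob_space_unif01)
  show "AE t in unif01. t \<in> {0..<1}"
    by (intro AE_uniform_measureI) auto
qed

lemma rat_pp_integrable:
  assumes "f \<in> rat_pp I" "finite I"
  shows "integrable (PiM I (\<lambda>_. unif01)) f"
proof -
  interpret prob_space "PiM I (\<lambda>_. unif01)" by (rule prob_space_PiM_unif01)
  obtain B where "\<And>x. (\<forall>i\<in>I. x i \<in> {0..<1}) \<Longrightarrow> \<bar>f x\<bar> \<le> B"
    using rat_pp_bounded[OF assms(1)] by blast
  then show ?thesis
    using AE_PiM_unif01[OF assms(2)] rat_pp_measurable[OF assms(1)]
    by (intro integrable_const_bound[where B = B]) auto
qed

text \<open>Fubini removes one coordinate at a time without leaving the class; with no coordinate
  left the integrand is a rational constant and the measure is a probability.\<close>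

lemma rat_pp_integral_Rats:
  assumes "finite I" "f \<in> rat_pp I"
  shows "integral\<^sup>L (PiM I (\<lambda>_. unif01)) f \<in> \<rat>"
  using assms
proof (induction I arbitrary: f)
  case empty
  interpret prob_space "PiM {} (\<lambda>_::'a. unif01)" by (rule prob_space_PiM_unif01)
  have "\<exists>q\<in>\<rat>. f = (\<lambda>_. q)"
    using empty
  proof induction
    case (affine l)
    then show ?case by (auto simp: rat_affine_def)
  next
    case (pos l)
    then show ?case by (auto simp: rat_affine_def)
  qed auto
  then show ?case by (auto simp: prob_space)
next
  case (insert i I)
  interpret prob_space unif01 by (rule prob_space_unif01)
  interpret product_sigma_finite "\<lambda>_::'a. unif01" ..
  obtain g where g: "g \<in> rat_pp I" "\<And>x. has_bochner_integral unif01 (\<lambda>t. f (x(i := t))) (g x)"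
    using rat_pp_integrate_coord[OF insert.prems insert.hyps] by blast
  have "integral\<^sup>L (PiM (insert i I) (\<lambda>_. unif01)) f = integral\<^sup>L (PiM I (\<lambda>_. unif01)) g"
    using insert.hyps insert.prems
    by (simp add: product_integral_insert rat_pp_integrable has_bochner_integral_integral_eq[OF g(2)])
  then show ?case using insert.IH[OF g(1)] by simp
qed

subsection \<open>Radial homeomorphisms of the plane\<close>

text \<open>The nodes are added in increasing order. The map built so far is kept up to the last
  node and replaced beyond it by a ray through the new point.\<close>

lemma strict_mono_extension:
  fixes g :: "real \<Rightarrow> real"
  assumes "finite S" "strict_mono_on S g"
  shows "\<exists>h. strict_mono h \<and> surj h \<and> (\<forall>s\<in>S. h s = g s)"
  using assms
proof (induction rule: finite_linorder_max_induct)
  case empty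
  then show ?case by (intro exI[of _ id]) (auto simp: strict_mono_def)
next
  case (insert b S)
  then obtain h where h: "strict_mono h" "surj h" "\<forall>s\<in>S. h s = g s"
    by (meson monotone_on_subset subset_insertI)
  show ?case
  proof (cases "S = {}")
    case True
    have "surj (\<lambda>t. t - b + g b)" by (intro surjI[of _ "\<lambda>u. u - g b + b"]) simp
    then show ?thesis
      using True by (intro exI[of _ "\<lambda>t. t - b + g b"]) (auto simp: strict_mono_def)
  next
    case False
    define s where "s = Max S"
    have "s \<in> S" using False insert by (simp add: s_def)
    then have "s < b" "g s < g b" "h s = g s"
      using insert h by (auto simp: strict_mono_on_def)
    \<comment> \<open>The slope joining the last old node to the new one; it is positive because
      \<open>g\<close> increases strictly.\<close>
    define k where "k = (g b - g s) / (b - s)"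
    have "k > 0" using \<open>s < b\<close> \<open>g s < g b\<close> by (simp add: k_def)
    define h' where "h' t = (if t \<le> s then h t else h s + (t - s) * k)" for t
    have "strict_mono h'"
    proof (rule strict_monoI)
      fix x y :: real assume "x < y"
      consider "y \<le> s" | "x \<le> s" "s < y" | "s < x" by linarith
      then show "h' x < h' y"
      proof cases
        case 1
        then show ?thesis using \<open>x < y\<close> h(1) by (simp add: h'_def strict_mono_def)
      next
        case 2
        have "h x \<le> h s" using 2 h(1) by (simp add: strict_mono_less_eq)
        moreover have "(y - s) * k > 0" using 2 \<open>k > 0\<close> by simp
        ultimately show ?thesis using 2 by (simp add: h'_def)
      next
        case 3
        then show ?thesis using \<open>x < y\<close> \<open>k > 0\<close> by (simp add: h'_def)
      qed
    qed
    moreover have "\<exists>t. h' t = u" for u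
    proof (cases "u \<le> h s")
      case True
      obtain t where "u = h t" using h(2) by (meson surjD)
      with True have "t \<le> s" using h(1) by (simp add: strict_mono_less_eq)
      then show ?thesis using \<open>u = h t\<close> by (auto simp: h'_def)
    next
      case False
      then have "(u - h s) / k > 0" using \<open>k > 0\<close> by simp
      then show ?thesis using \<open>k > 0\<close>
        by (intro exI[of _ "s + (u - h s) / k"]) (simp add: h'_def)
    qed
    then have "surj h'" by (metis surjI)
    moreover have "h' t = g t" if "t \<in> insert b S" for t
    proof (cases "t = b")
      case True
      then show ?thesis using \<open>s < b\<close> \<open>h s = g s\<close> by (simp add: h'_def k_def)
    next
      case False
      then have "t \<in> S" using that by simp
      moreover have "t \<le> s" using \<open>t \<in> S\<close> insert by (simp add: s_def)
      ultimately show ?thesis using h by (simp add: h'_def)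
    qed
    ultimately show ?thesis by blast
  qed
qed

section \<open>Circle homeomorphisms, their lifts and radial extensions\<close>

abbreviation circ :: "real \<Rightarrow> complex" where
  "circ t \<equiv> cis (2 * pi * t)"

lemma circ_eq_iff: "circ s = circ t \<longleftrightarrow> s - t \<in> \<int>"
proof -
  have *: "2 * pi * s = 2 * pi * t + 2 * pi * of_int k \<longleftrightarrow> s - t = of_int k" for k
  proof -
    have "2 * pi * s = 2 * pi * t + 2 * pi * of_int k \<longleftrightarrow> 2 * pi * (s - t) = 2 * pi * of_int k"
      by (simp only: right_diff_distrib diff_eq_eq add.commute)
    then show ?thesis by simp
  qed
  have "circ s = circ t \<longleftrightarrow> sin (2 * pi * s) = sin (2 * pi * t) \<and> cos (2 * pi * s) = cos (2 * pi * t)"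
    by (auto simp: complex_eq_iff)
  also have "\<dots> \<longleftrightarrow> (\<exists>k::int. s - t = of_int k)"
    by (simp only: sin_cos_eq_iff *)
  finally show ?thesis by (auto simp: Ints_def)
qed

lemma polar_circ: "\<exists>t. z = of_real (cmod z) * circ t"
  using rcis_cmod_Arg[of z] by (intro exI[of _ "Arg z / (2 * pi)"]) (simp add: rcis_def)

text \<open>These are the lifts to the line of orientation-preserving homeomorphisms of the circle
  of length \<open>1\<close>. Continuity follows from monotonicity and surjectivity, see
  \<open>circle_lift_isCont\<close>.\<close>

definition circle_lift :: "(real \<Rightarrow> real) \<Rightarrow> bool" where
  "circle_lift H \<longleftrightarrow> strict_mono H \<and> surj H \<and> (\<forall>t. H (t + 1) = H t + 1)"

lemma circle_lift_add_int:
  assumes "circle_lift H"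
  shows "H (t + of_int k) = H t + of_int k"
proof -
  have nat: "H (t + of_nat m) = H t + of_nat m" for t m
  proof (induction m)
    case (Suc m)
    have "H ((t + of_nat m) + 1) = H (t + of_nat m) + 1"
      using assms by (simp add: circle_lift_def del: add.assoc)
    then show ?case using Suc by (simp add: add_ac)
  qed simp
  show ?thesis
  proof (cases k)
    case (nonneg m)
    then show ?thesis using nat by simp
  next
    case (neg m)
    then have "t + of_int k + of_nat (Suc m) = t" by simp
    then show ?thesis using nat[of "t + of_int k" "Suc m"] neg by simp
  qed
qed

lemma circle_lift_diff_Ints_iff:
  assumes "circle_lift H"
  shows "H s - H t \<in> \<int> \<longleftrightarrow> s - t \<in> \<int>"
proof
  assume "H s - H t \<in> \<int>"
  then obtain k where "H s = H (t + of_int k)"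
    by (elim Ints_cases) (auto simp: circle_lift_add_int[OF assms] algebra_simps)
  then show "s - t \<in> \<int>"
    using assms by (auto simp: circle_lift_def strict_mono_eq)
next
  assume "s - t \<in> \<int>"
  then obtain k where "s = t + of_int k" by (elim Ints_cases) (auto simp: algebra_simps)
  then show "H s - H t \<in> \<int>" by (simp add: circle_lift_add_int[OF assms])
qed

lemma circle_lift_inv:
  assumes "circle_lift H"
  shows "circle_lift (inv H)"
proof -
  have H: "strict_mono H" "surj H" "\<And>t. H (t + 1) = H t + 1"
    using assms by (auto simp: circle_lift_def)
  have inj: "inj H" using H(1) by (rule strict_mono_imp_inj_on)
  have "strict_mono (inv H)"
    using H by (intro strict_monoI) (metis strict_mono_less surj_f_inv_f)
  moreover have "surj (inv H)" by (simp add: inj inj_imp_surj_inv)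
  moreover have "inv H (t + 1) = inv H t + 1" for t
    using H inj by (metis inv_f_f surj_f_inv_f)
  ultimately show ?thesis by (simp add: circle_lift_def)
qed

lemma circle_lift_isCont: "circle_lift H \<Longrightarrow> isCont H t"
  using continuous_onI_mono[of H UNIV]
  by (auto simp: circle_lift_def strict_mono_less_eq continuous_on_eq_continuous_at)

text \<open>The homeomorphism of the plane that preserves moduli and acts on arguments, measured in
  full turns, by the lift \<open>H\<close> of a circle homeomorphism.\<close>

definition radial :: "(real \<Rightarrow> real) \<Rightarrow> complex \<Rightarrow> complex" where
  "radial H z = of_real (cmod z) * circ (H (Arg2pi z / (2 * pi)))"

text \<open>Any angle \<open>t\<close> may replace the one chosen by \<open>Arg2pi\<close>: two
  angles of a point differ by an integer, and so do their images under \<open>H\<close>.\<close>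

lemma radial_polar:
  assumes "circle_lift H" "r \<ge> 0"
  shows "radial H (of_real r * circ t) = of_real r * circ (H t)"
proof (cases "r = 0")
  case False
  define z where "z = of_real r * circ t"
  have r: "cmod z = r" using assms by (simp add: z_def norm_mult)
  have "z = of_real r * circ (Arg2pi z / (2 * pi))"
    using Arg2pi_eq[of z] by (simp add: r cis_conv_exp)
  then have "circ (Arg2pi z / (2 * pi)) = circ t"
    using False unfolding z_def by (metis mult_left_cancel of_real_eq_0_iff)
  then have "circ (H (Arg2pi z / (2 * pi))) = circ (H t)"
    using assms by (simp only: circ_eq_iff circle_lift_diff_Ints_iff)
  then show ?thesis unfolding radial_def z_def[symmetric] by (simp add: r)
qed (simp add: radial_def)

lemma radial_circ: "circle_lift H \<Longrightarrow> radial H (circ t) = circ (H t)"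
  using radial_polar[of H 1 t] by simp

lemma radial_inverse:
  assumes "circle_lift H" "circle_lift G" "\<And>t. G (H t) = t"
  shows "radial G (radial H z) = z"
proof -
  obtain t where t: "z = of_real (cmod z) * circ t" using polar_circ by blast
  show ?thesis
    by (subst (1 2) t) (simp add: radial_polar assms)
qed

lemma radial_eq_0_iff: "radial H z = 0 \<longleftrightarrow> z = 0"
  by (simp add: radial_def)

lemma bij_radial:
  assumes "circle_lift H"
  shows "bij (radial H)"
proof -
  have "strict_mono H" "surj H" using assms by (auto simp: circle_lift_def)
  then show ?thesis
    using assms circle_lift_inv[OF assms]
    by (intro o_bij[of "radial (inv H)"]) (auto simp: fun_eq_iff radial_inverse surj_f_inv_f strict_mono_imp_inj_on inv_f_f)
qed

text \<open>Two branches of the argument cover the punctured plane: \<open>Arg2pi\<close> is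
  continuous off the nonnegative reals and \<open>Arg\<close> off the nonpositive ones. By
  \<open>radial_polar\<close> both compute the same map.\<close>

lemma isCont_radial:
  assumes "circle_lift H" "z \<noteq> 0"
  shows "isCont (radial H) z"
proof (cases "z \<in> \<real>\<^sub>\<ge>\<^sub>0")
  case False
  show ?thesis
    unfolding radial_def
    by (intro continuous_intros continuous_at_Arg2pi False isCont_o2[OF _ circle_lift_isCont[OF assms(1)]]
        isCont_o2[OF _ continuous_on_interior[OF continuous_on_cis[OF continuous_on_id, of UNIV]]]) auto
next
  case True
  then have z: "z \<notin> \<real>\<^sub>\<le>\<^sub>0" using assms(2) by (auto simp: nonpos_Reals_def nonneg_Reals_def)
  have "radial H z = of_real (cmod z) * circ (H (Arg z / (2 * pi)))" for z
    using rcis_cmod_Arg[of z] radial_polar[OF assms(1), of "cmod z" "Arg z / (2 * pi)"]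
    by (simp add: rcis_def)
  then have *: "radial H = (\<lambda>z. of_real (cmod z) * circ (H (Arg z / (2 * pi))))" ..
  show ?thesis
    unfolding *
    by (intro continuous_intros continuous_at_Arg z isCont_o2[OF _ circle_lift_isCont[OF assms(1)]]
        isCont_o2[OF _ continuous_on_interior[OF continuous_on_cis[OF continuous_on_id, of UNIV]]]) auto
qed

lemma radial_homeomorphism:
  assumes "circle_lift H" "0 \<notin> S"
  shows "homeomorphism S (radial H ` S) (radial H) (radial (inv H))"
proof -
  have H: "strict_mono H" "surj H" using assms by (auto simp: circle_lift_def)
  note inv = circle_lift_inv[OF assms(1)]
  have id: "radial (inv H) (radial H z) = z" for z
    using H by (intro radial_inverse assms(1) inv) (simp add: strict_mono_imp_inj_on)
  show ?thesis
  proof (rule homeomorphismI)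
    show "continuous_on S (radial H)"
      using assms by (intro continuous_at_imp_continuous_on ballI isCont_radial) auto
    show "continuous_on (radial H ` S) (radial (inv H))"
      using assms inv by (intro continuous_at_imp_continuous_on ballI isCont_radial)
        (auto simp: radial_eq_0_iff)
  qed (auto simp: id)
qed

section \<open>Regions and bisectors in angular coordinates\<close>

lemma components_homeomorphism:
  assumes "homeomorphism S T f g"
  shows "components T = image f ` components S"
proof -
  have "T = f ` S" using assms by (simp add: homeomorphism_def)
  then show ?thesis
    unfolding components_def
    using connected_component_set_homeomorphism[OF assms] by (auto simp: image_image)
qed

text \<open>The inner product defining the bisector factors as
  \<open>2 * r * sin (pi * (2 * t - a - b)) * sin (pi * (b - a))\<close>. The last alternative is
  the degenerate case of equal endpoints, where \<open>perp_bisector\<close> is the whole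
  plane.\<close>

lemma mem_perp_bisector_circ:
  "of_real r * circ t \<in> perp_bisector (circ a) (circ b) \<longleftrightarrow>
     r = 0 \<or> 2 * t - a - b \<in> \<int> \<or> a - b \<in> \<int>"
proof -
  have sin_Ints: "sin (pi * s) = 0 \<longleftrightarrow> s \<in> \<int>" for s
    by (auto simp: sin_zero_iff_int2 Ints_def mult.commute)
  have norm: "midpoint (circ a) (circ b) \<bullet> (circ b - circ a) = 0"
    by (simp add: midpoint_def inner_diff_right inner_add_left inner_commute[of "circ b"]
        dot_square_norm)
  have "(of_real r * circ t) \<bullet> (circ b - circ a) =
      r * (cos (2 * pi * t - 2 * pi * b) - cos (2 * pi * t - 2 * pi * a))"
    by (simp add: inner_complex_def cos_diff algebra_simps)
  also have "\<dots> = r * (2 * sin (pi * (2 * t - a - b)) * sin (pi * (b - a)))"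
  proof -
    have "((2 * pi * t - 2 * pi * b) + (2 * pi * t - 2 * pi * a)) / 2 = pi * (2 * t - a - b)"
      "((2 * pi * t - 2 * pi * a) - (2 * pi * t - 2 * pi * b)) / 2 = pi * (b - a)"
      by (simp_all add: field_simps)
    then show ?thesis by (simp only: cos_diff_cos mult.assoc)
  qed
  finally show ?thesis
    unfolding perp_bisector_def using Ints_minus[of "a - b"] Ints_minus[of "b - a"]
    by (auto simp: inner_diff_left norm sin_Ints)
qed

lemma ccw_cyclic_radial:
  assumes "circle_lift H" "ccw_cyclic m P"
  shows "ccw_cyclic m (radial H \<circ> P)"
proof -
  obtain \<theta> where \<theta>: "\<And>i. i < m \<Longrightarrow> P i = cis (\<theta> i)"
    "\<And>i j. i < j \<Longrightarrow> j < m \<Longrightarrow> \<theta> i < \<theta> j \<and> \<theta> j < \<theta> i + 2 * pi"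
    using assms(2) unfolding ccw_cyclic_def by blast
  define \<phi> where "\<phi> i = 2 * pi * H (\<theta> i / (2 * pi))" for i
  have "(radial H \<circ> P) i = cis (\<phi> i)" if "i < m" for i
    using radial_circ[OF assms(1), of "\<theta> i / (2 * pi)"] \<theta>(1)[OF that] by (simp add: \<phi>_def)
  moreover have "\<phi> i < \<phi> j \<and> \<phi> j < \<phi> i + 2 * pi" if "i < j" "j < m" for i j
  proof -
    have "\<theta> i / (2 * pi) < \<theta> j / (2 * pi)" "\<theta> j / (2 * pi) < \<theta> i / (2 * pi) + 1"
      using \<theta>(2)[OF that] by (auto simp: field_simps)
    then have "H (\<theta> i / (2 * pi)) < H (\<theta> j / (2 * pi))"
      "H (\<theta> j / (2 * pi)) < H (\<theta> i / (2 * pi)) + 1"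
      using assms(1) unfolding circle_lift_def by (metis strict_mono_less)+
    then have "\<phi> i < \<phi> j" "\<phi> j < 2 * pi * (H (\<theta> i / (2 * pi)) + 1)"
      unfolding \<phi>_def by (simp_all only: mult_less_cancel_left_pos pi_gt_zero zero_less_mult_iff zero_less_numeral simp_thms)
    then show ?thesis by (simp add: \<phi>_def algebra_simps)
  qed
  ultimately show ?thesis unfolding ccw_cyclic_def by blast
qed

section \<open>Transfer of generic collections and occupancy words\<close>

context
  fixes H :: "real \<Rightarrow> real" and P P' :: "nat \<Rightarrow> complex" and n :: nat
  assumes H: "circle_lift H" "H 0 = 0"
    and P': "\<And>i. i < n \<Longrightarrow> P' i = radial H (P i)"
    and lines: "\<And>i. i < n \<Longrightarrow> bisector_line n P' i = radial H ` bisector_line n P i"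
begin

lemma radial_1: "radial H 1 = 1"
  using radial_circ[OF H(1), of 0] H(2) by simp

lemma radial_mem_iff: "radial H z \<in> radial H ` A \<longleftrightarrow> z \<in> A"
  using bij_radial[OF H(1)] by (simp add: bij_is_inj inj_image_mem_iff)

lemma generic_collection_radial:
  assumes "generic_collection n P"
  shows "generic_collection n P'"
proof -
  note gen = assms[unfolded generic_collection_def]
  have "ccw_cyclic n (radial H \<circ> P)" using gen H by (intro ccw_cyclic_radial) auto
  then have "ccw_cyclic n P'" by (simp add: ccw_cyclic_def P')
  moreover have "inj_on (bisector_line n P') {..<n}"
    using gen bij_is_inj[OF bij_radial[OF H(1)]] unfolding inj_on_def
    by (simp add: lines inj_image_eq_iff inj_def)
  moreover have "P' j \<notin> bisector_line n P' i" if "i < n" "j < n" for i j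
    using that gen by (simp add: lines P' radial_mem_iff)
  moreover have "1 \<notin> bisector_line n P' i" if "i < n" for i
    using that gen radial_mem_iff[of 1] by (simp add: lines radial_1)
  ultimately show ?thesis by (simp add: generic_collection_def)
qed

text \<open>The origin lies on the bisectors, so their complement avoids the one point where
  continuity of \<open>radial H\<close> has not been established. A homeomorphism of complements
  matches components.\<close>

lemma regions_radial:
  assumes "n > 0" "\<And>i. i < n \<Longrightarrow> 0 \<in> bisector_line n P i"
  shows "regions n P' = image (radial H) ` regions n P"
proof -
  let ?S = "- (\<Union>i<n. bisector_line n P i)"
  have "0 \<notin> ?S" using assms by auto
  have "(\<Union>i<n. bisector_line n P' i) = radial H ` (\<Union>i<n. bisector_line n P i)"
    using lines by auto
  then have "- (\<Union>i<n. bisector_line n P' i) = radial H ` ?S"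
    using bij_image_Compl_eq[OF bij_radial[OF H(1)]] by metis
  then show ?thesis
    unfolding regions_def
    using components_homeomorphism[OF radial_homeomorphism[OF H(1) \<open>0 \<notin> ?S\<close>]] by simp
qed

text \<open>The numbering and its representatives are pushed forward by \<open>radial H\<close>. The
  map fixes \<open>1\<close>, so the first region stays first, and counts are unchanged by
  injectivity.\<close>

lemma is_occupancy_word_radial:
  assumes "n > 0" "\<And>i. i < n \<Longrightarrow> 0 \<in> bisector_line n P i" "is_occupancy_word n P w"
  shows "is_occupancy_word n P' w"
proof -
  obtain R Q where R: "bij_betw R {..<2 * n} (regions n P)" "1 \<in> R 0"
    and Q: "\<forall>k<2 * n. Q k \<in> R k" "ccw_cyclic (2 * n) Q"
    and w: "w = map (\<lambda>k. card {j. j < n \<and> P j \<in> R k}) [0..<2 * n]"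
    using assms(3) unfolding is_occupancy_word_def ccw_numbering_def by blast
  define R' where "R' k = radial H ` R k" for k
  have "inj (image (radial H))"
    using inj_image_eq_iff[OF bij_is_inj[OF bij_radial[OF H(1)]]] by (auto intro: injI)
  then have "bij_betw (image (radial H)) (regions n P) (regions n P')"
    by (simp add: regions_radial assms bij_betw_imageI inj_on_subset)
  then have "bij_betw R' {..<2 * n} (regions n P')"
    using bij_betw_trans[OF R(1)] unfolding R'_def comp_def by blast
  moreover have "1 \<in> R' 0" using R(2) radial_1 unfolding R'_def by (metis imageI)
  moreover have "\<forall>k<2 * n. (radial H \<circ> Q) k \<in> R' k" using Q(1) by (simp add: R'_def)
  moreover have "ccw_cyclic (2 * n) (radial H \<circ> Q)" using H(1) Q(2) by (rule ccw_cyclic_radial)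
  ultimately have "ccw_numbering n P' R'" unfolding ccw_numbering_def by blast
  moreover have "{j. j < n \<and> P' j \<in> R' k} = {j. j < n \<and> P j \<in> R k}" for k
    by (simp add: P' R'_def radial_mem_iff cong: conj_cong)
  ultimately show ?thesis unfolding is_occupancy_word_def w by (intro exI[of _ R']) simp
qed

end

text \<open>A radial map need not send lines to lines. The second assumption says that
  \<open>H\<close> matches the directions of the two bisectors; since moduli are preserved, this is
  enough.\<close>

lemma perp_bisector_radial:
  assumes "circle_lift H"
    and "\<And>t. 2 * t - a - b \<in> \<int> \<longleftrightarrow> 2 * H t - H a - H b \<in> \<int>"
  shows "perp_bisector (circ (H a)) (circ (H b)) = radial H ` perp_bisector (circ a) (circ b)"
proof -
  have *: "radial H z \<in> perp_bisector (circ (H a)) (circ (H b)) \<longleftrightarrow> z \<in> perp_bisector (circ a) (circ b)"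
    for z
  proof -
    obtain t where t: "z = of_real (cmod z) * circ t" using polar_circ by blast
    show ?thesis
      by (subst (1 2) t)
        (simp add: radial_polar[OF assms(1)] mem_perp_bisector_circ assms(2)
          circle_lift_diff_Ints_iff[OF assms(1)])
  qed
  show ?thesis
  proof (intro equalityI subsetI)
    fix z assume "z \<in> perp_bisector (circ (H a)) (circ (H b))"
    moreover obtain y where "z = radial H y"
      using bij_radial[OF assms(1)] by (meson bij_pointE)
    ultimately show "z \<in> radial H ` perp_bisector (circ a) (circ b)" using * by blast
  qed (use * in blast)
qed

section \<open>Invariance of the bracelet event\<close>

definition bracelet_event :: "nat \<Rightarrow> nat list set \<Rightarrow> (nat \<Rightarrow> complex) \<Rightarrow> bool" where
  "bracelet_event n b X \<longleftrightarrow>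
     (\<exists>\<sigma> w. \<sigma> permutes {..<n} \<and> generic_collection n (X \<circ> \<sigma>) \<and>
        is_occupancy_word n (X \<circ> \<sigma>) w \<and> bracelet_rel `` {w} = b)"

text \<open>The same labelling and the same word witness both events. The bisector condition is
  imposed on all pairs of points because the labelling decides which pairs are neighbours.\<close>

lemma bracelet_event_circle_lift:
  assumes H: "circle_lift H" "H 0 = 0" and "n > 0"
    and x': "\<And>i. i < n \<Longrightarrow> x' i = H (x i)"
    and iff: "\<And>i j t. i < n \<Longrightarrow> j < n \<Longrightarrow>
      2 * t - x i - x j \<in> \<int> \<longleftrightarrow> 2 * H t - x' i - x' j \<in> \<int>"
    and X: "\<And>i. i < n \<Longrightarrow> X i = circ (x i)" "\<And>i. i < n \<Longrightarrow> X' i = circ (x' i)"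
    and ev: "bracelet_event n b X"
  shows "bracelet_event n b X'"
proof -
  obtain \<sigma> w where \<sigma>: "\<sigma> permutes {..<n}" and gen: "generic_collection n (X \<circ> \<sigma>)"
    and w: "is_occupancy_word n (X \<circ> \<sigma>) w" "bracelet_rel `` {w} = b"
    using ev unfolding bracelet_event_def by blast
  have \<sigma>_less: "\<sigma> i < n" if "i < n" for i
    using permutes_in_image[OF \<sigma>, of i] that by simp
  have P': "(X' \<circ> \<sigma>) i = radial H ((X \<circ> \<sigma>) i)" if "i < n" for i
    using \<sigma>_less[OF that] by (simp add: X x' radial_circ[OF H(1)])
  have lines: "bisector_line n (X' \<circ> \<sigma>) i = radial H ` bisector_line n (X \<circ> \<sigma>) i"
    and zero: "0 \<in> bisector_line n (X \<circ> \<sigma>) i" if "i < n" for i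
  proof -
    have less: "\<sigma> i < n" "\<sigma> (Suc i mod n) < n"
      using \<sigma>_less that \<open>n > 0\<close> by simp_all
    show "bisector_line n (X' \<circ> \<sigma>) i = radial H ` bisector_line n (X \<circ> \<sigma>) i"
      using perp_bisector_radial[OF H(1), of "x (\<sigma> i)" "x (\<sigma> (Suc i mod n))"] iff[OF less]
      by (simp add: bisector_line_def X x' less)
    show "0 \<in> bisector_line n (X \<circ> \<sigma>) i"
      using mem_perp_bisector_circ[of 0] by (simp add: bisector_line_def X less)
  qed
  have "generic_collection n (X' \<circ> \<sigma>)"
    using generic_collection_radial[OF H P' lines gen] by simp
  moreover have "is_occupancy_word n (X' \<circ> \<sigma>) w"
    using is_occupancy_word_radial[OF H P' lines \<open>n > 0\<close> zero w(1)] by simp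
  ultimately show ?thesis using \<sigma> w(2) unfolding bracelet_event_def by blast
qed

text \<open>The graph of \<open>h\<close> over the unit interval is repeated along the diagonal; the
  values \<open>0\<close> and \<open>1\<close> at the ends make the pieces fit.\<close>

lemma periodic_extension:
  assumes "strict_mono h" "surj h" "h 0 = 0" "h 1 = (1::real)"
  defines "H \<equiv> \<lambda>t. of_int \<lfloor>t\<rfloor> + h (frac t)"
  shows "circle_lift H" "\<And>t. 0 \<le> t \<Longrightarrow> t \<le> 1 \<Longrightarrow> H t = h t"
proof -
  have h01: "0 \<le> h t \<longleftrightarrow> 0 \<le> t" "h t < 1 \<longleftrightarrow> t < 1" for t
    using assms(1,3,4) by (metis strict_mono_less_eq, metis strict_mono_less)
  show eq: "H t = h t" if "0 \<le> t" "t \<le> 1" for t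
  proof (cases "t = 1")
    case False
    then have "\<lfloor>t\<rfloor> = 0" using that by (simp add: floor_eq_iff)
    then show ?thesis by (simp add: H_def frac_def)
  qed (simp add: H_def assms)
  have frac_h: "0 \<le> h (frac t)" "h (frac t) < 1" for t
    using h01[of "frac t"] frac_ge_0[of t] frac_lt_1[of t] by simp_all
  have "H s < H t" if "s < t" for s t
  proof (cases "\<lfloor>s\<rfloor> = \<lfloor>t\<rfloor>")
    case True
    then have "frac s < frac t" using that by (simp add: frac_def)
    then show ?thesis using True assms(1) by (simp add: H_def strict_mono_less)
  next
    case False
    then have "\<lfloor>s\<rfloor> + 1 \<le> \<lfloor>t\<rfloor>" using floor_mono[of s t] that by linarith
    then have "of_int \<lfloor>s\<rfloor> + 1 \<le> (of_int \<lfloor>t\<rfloor> :: real)" by linarith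
    then show ?thesis using frac_h[of s] frac_h[of t] by (simp add: H_def)
  qed
  then have "strict_mono H" by (rule strict_monoI)
  moreover have "\<exists>t. H t = u" for u
  proof -
    obtain s where s: "h s = frac u" using assms(2) by (metis surjD)
    then have "0 \<le> s" "s < 1" using h01[of s] frac_ge_0[of u] frac_lt_1[of u] by simp_all
    then have "\<lfloor>of_int \<lfloor>u\<rfloor> + s\<rfloor> = \<lfloor>u\<rfloor>" by (simp add: floor_eq_iff)
    then have "H (of_int \<lfloor>u\<rfloor> + s) = u" using s by (simp add: H_def frac_def)
    then show ?thesis ..
  qed
  then have "surj H" by (metis surjI)
  moreover have "H (t + 1) = H t + 1" for t by (simp add: H_def frac_def)
  ultimately show "circle_lift H" by (simp add: circle_lift_def)
qed

text \<open>For points at angles \<open>x i \<in> {0..<1}\<close> (in turns), the bisector of the \<open>i\<close>th and \<open>j\<close>th point meets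
  the circle at those of the values \<open>(x i + x j + m) / 2\<close> that lie in \<open>{0..<1}\<close>; the case \<open>i = j\<close>,
  \<open>m = 0\<close> gives the points themselves.\<close>

definition marks :: "nat \<Rightarrow> ((nat \<Rightarrow> real) \<Rightarrow> real) set" where
  "marks n = {\<lambda>x. 0, \<lambda>x. 1} \<union>
     (\<lambda>(i, j, m). \<lambda>x. (x i + x j + m) / 2) ` ({..<n} \<times> {..<n} \<times> {-1, 0, 1})"

lemma finite_marks: "finite (marks n)"
  by (simp add: marks_def)

lemma marks_affine:
  assumes "l \<in> marks n"
  shows "l \<in> rat_affine {..<n}"
proof -
  have mark: "(\<lambda>x. (x i + x j + m) / 2) \<in> rat_affine {..<n}"
    if "i < n" "j < n" "m \<in> \<rat>" for i j m
  proof -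
    have "(\<lambda>x. (1 / 2) * (x i + x j + m)) \<in> rat_affine {..<n}"
      using that by (intro rat_affine_scale rat_affine_add rat_affine_coord rat_affine_const) auto
    then show ?thesis by simp
  qed
  show ?thesis
    using assms mark[of _ _ "-1"] mark[of _ _ 0] mark[of _ _ 1]
    by (auto simp: marks_def rat_affine_const)
qed

lemma mark_in_marks:
  "i < n \<Longrightarrow> j < n \<Longrightarrow> m \<in> {-1, 0, 1} \<Longrightarrow> (\<lambda>x. (x i + x j + m) / 2) \<in> marks n"
  unfolding marks_def by (intro UnI2 image_eqI[of _ _ "(i, j, m)"]) auto

lemma coord_in_marks: "i < n \<Longrightarrow> (\<lambda>x. x i) \<in> marks n"
  using mark_in_marks[of i n i 0] by simp

text \<open>Equal order of the marks makes \<open>l x \<mapsto> l x'\<close> strictly increasing on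
  a finite set, hence extendable. The conclusion is limited to marks in the unit interval, where the
  periodic extension agrees with the interpolating map.\<close>

lemma exists_circle_lift_marks:
  assumes "\<And>l l'. l \<in> marks n \<Longrightarrow> l' \<in> marks n \<Longrightarrow> l x < l' x \<longleftrightarrow> l x' < l' x'"
  obtains H where "circle_lift H" "H 0 = 0"
    "\<And>l. l \<in> marks n \<Longrightarrow> 0 \<le> l x \<Longrightarrow> l x \<le> 1 \<Longrightarrow> H (l x) = l x'"
proof -
  define S where "S = (\<lambda>l. l x) ` marks n"
  \<comment> \<open>Several marks may share a value at \<open>x\<close>. The choice is harmless:
    marks that tie at \<open>x\<close> also tie at \<open>x'\<close>, since neither is below the
    other.\<close>
  define g where "g s = (SOME u. \<exists>l\<in>marks n. s = l x \<and> u = l x')" for s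
  have g: "g (l x) = l x'" if "l \<in> marks n" for l
  proof -
    have "\<exists>l'\<in>marks n. l x = l' x \<and> g (l x) = l' x'"
      unfolding g_def by (rule someI_ex) (use that in blast)
    then obtain l' where "l' \<in> marks n" "l x = l' x" "g (l x) = l' x'" by blast
    then show ?thesis
      using assms[OF that, of l'] assms[of l' l] that by simp
  qed
  have "strict_mono_on S g"
    unfolding S_def by (rule strict_mono_onI) (auto simp: g assms)
  then obtain h where h: "strict_mono h" "surj h" "\<forall>s\<in>S. h s = g s"
    using strict_mono_extension[of S g] finite_marks by (auto simp: S_def)
  have hl: "h (l x) = l x'" if "l \<in> marks n" for l
    using h(3) g that by (simp add: S_def)
  \<comment> \<open>The constant marks pin the interpolating map at both ends of the period.\<close>
  have "(\<lambda>x. 0) \<in> marks n" "(\<lambda>x. 1) \<in> marks n" by (auto simp: marks_def)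
  from hl[OF this(1)] hl[OF this(2)] have h01: "h 0 = 0" "h 1 = 1" by simp_all
  note H = periodic_extension[OF h(1,2) h01]
  show ?thesis
    using H(2)[of 0] h01 by (intro that[OF H(1)]) (simp_all add: H(2) hl)
qed

text \<open>Within one period the directions of all bisectors are marks, so the lift carries them to
  the corresponding directions at \<open>x'\<close>. Periodicity extends this to all angles.\<close>

lemma bracelet_event_same_marks_order:
  assumes "n > 0"
    and x: "\<And>i. i < n \<Longrightarrow> x i \<in> {0..<1}" "\<And>i. i < n \<Longrightarrow> x' i \<in> {0..<1}"
    and marks: "\<And>l l'. l \<in> marks n \<Longrightarrow> l' \<in> marks n \<Longrightarrow> l x < l' x \<longleftrightarrow> l x' < l' x'"
    and X: "\<And>i. i < n \<Longrightarrow> X i = circ (x i)" "\<And>i. i < n \<Longrightarrow> X' i = circ (x' i)"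
    and ev: "bracelet_event n b X"
  shows "bracelet_event n b X'"
proof -
  obtain H where H: "circle_lift H" "H 0 = 0"
    and Hl: "\<And>l. l \<in> marks n \<Longrightarrow> 0 \<le> l x \<Longrightarrow> l x \<le> 1 \<Longrightarrow> H (l x) = l x'"
    using exists_circle_lift_marks[of n x x'] marks by blast
  have "strict_mono H" using H by (simp add: circle_lift_def)
  then have inj: "H s = H t \<longleftrightarrow> s = t" for s t by (simp add: strict_mono_eq)
  have x': "x' i = H (x i)" if "i < n" for i
    using Hl[OF coord_in_marks[OF that]] x(1)[OF that] by simp
  \<comment> \<open>Here \<open>2 * t - a - b\<close> lies strictly between \<open>-2\<close> and
    \<open>2\<close>, which is why three shifts suffice in \<open>marks\<close>.\<close>
  have range: "m \<in> {-1, 0, 1}" if "t \<in> {0..<1}" "a \<in> {0..<1}" "b \<in> {0..<1}"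
      "2 * t - a - b = of_int m" for t a b :: real and m :: int
    using that by auto
  have iff01: "2 * t - x i - x j \<in> \<int> \<longleftrightarrow> 2 * H t - x' i - x' j \<in> \<int>"
    if ij: "i < n" "j < n" and t: "t \<in> {0..<1}" for i j t
  proof
    assume "2 * t - x i - x j \<in> \<int>"
    then obtain m where m: "2 * t - x i - x j = of_int m" by (elim Ints_cases)
    then have "real_of_int m \<in> {-1, 0, 1}" using range[OF t x(1)[OF ij(1)] x(1)[OF ij(2)]] by auto
    moreover have "t = (x i + x j + of_int m) / 2" using m by simp
    ultimately have "H t = (x' i + x' j + of_int m) / 2"
      using Hl[OF mark_in_marks[OF ij, of "of_int m"]] t
      by (metis atLeastLessThan_iff less_imp_le)
    then have "2 * H t - x' i - x' j = of_int m" by simp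
    then show "2 * H t - x' i - x' j \<in> \<int>" by (simp only: Ints_of_int)
  next
    have Ht: "H t \<in> {0..<1}"
      using t H \<open>strict_mono H\<close> strict_mono_less_eq[of H 0 t] strict_mono_less[of H t 1]
        circle_lift_add_int[OF H(1), of 0 1] by simp
    assume "2 * H t - x' i - x' j \<in> \<int>"
    then obtain m where m: "2 * H t - x' i - x' j = of_int m" by (elim Ints_cases)
    then have "real_of_int m \<in> {-1, 0, 1}" using range[OF Ht x(2)[OF ij(1)] x(2)[OF ij(2)]] by auto
    note mark = mark_in_marks[OF ij this]
    have eq: "H t = (x' i + x' j + of_int m) / 2" using m by simp
    \<comment> \<open>Comparison with the constant marks \<open>0\<close> and \<open>1\<close>
      brings the range of the mark back from \<open>x'\<close> to \<open>x\<close>.\<close>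
    have "0 \<le> (x i + x j + of_int m) / 2" "(x i + x j + of_int m) / 2 \<le> 1"
      using marks[OF mark, of "\<lambda>x. 0"] marks[OF _ mark, of "\<lambda>x. 1"] Ht
      unfolding eq by (auto simp: marks_def)
    then have "H t = H ((x i + x j + of_int m) / 2)"
      using Hl[OF mark] eq by simp
    then have "t = (x i + x j + of_int m) / 2" by (simp add: inj)
    then have "2 * t - x i - x j = of_int m" by simp
    then show "2 * t - x i - x j \<in> \<int>" by (simp only: Ints_of_int)
  qed
  have iff: "2 * t - x i - x j \<in> \<int> \<longleftrightarrow> 2 * H t - x' i - x' j \<in> \<int>"
    if ij: "i < n" "j < n" for i j t
  proof -
    \<comment> \<open>Passing from \<open>t\<close> to \<open>frac t\<close> changes both
      expressions by the same integer \<open>2 * \<lfloor>t\<rfloor>\<close>.\<close>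
    have "frac t \<in> {0..<1}" by (simp add: frac_lt_1)
    from iff01[OF ij this]
    have "2 * frac t - x i - x j \<in> \<int> \<longleftrightarrow> 2 * H (frac t) - x' i - x' j \<in> \<int>" .
    moreover have "H t = H (frac t) + of_int \<lfloor>t\<rfloor>"
      using circle_lift_add_int[OF H(1), of "frac t" "\<lfloor>t\<rfloor>"] by (simp add: frac_def)
    moreover have "2 * t - x i - x j = 2 * frac t - x i - x j + of_int (2 * \<lfloor>t\<rfloor>)"
      by (simp add: frac_def)
    moreover have "u + of_int k \<in> \<int> \<longleftrightarrow> u \<in> \<int>" for u :: real and k :: int
      using Ints_add[of u "of_int k"] Ints_diff[of "u + of_int k" "of_int k"] by auto
    moreover have "2 * H t - x' i - x' j = 2 * H (frac t) - x' i - x' j + of_int (2 * \<lfloor>t\<rfloor>)"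
      using \<open>H t = H (frac t) + of_int \<lfloor>t\<rfloor>\<close> by simp
    ultimately show ?thesis by metis
  qed
  show ?thesis
    by (rule bracelet_event_circle_lift[OF H \<open>n > 0\<close> x' iff X ev])
qed

subsection \<open>Rationality\<close>

text \<open>Measuring angles in turns removes \<open>pi\<close> from the model, so that all
  thresholds become rational affine.\<close>

lemma uniform_circle_eq: "uniform_circle = distr unif01 borel circ"
proof -
  have "uniform_measure lborel {0..<2 * pi} = distr unif01 borel (\<lambda>t. 2 * pi * t)"
  proof (rule measure_eqI)
    fix A assume "A \<in> sets (uniform_measure lborel {0..<2 * pi})"
    then have [measurable]: "A \<in> sets borel" by simp
    then have A: "(\<lambda>t. 2 * pi * t) -` A \<in> sets lborel"
      using measurable_sets_borel[of "\<lambda>t. 2 * pi * t" borel A] by simp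
    let ?B = "{0..<2 * pi} \<inter> A"
    have "emeasure (distr unif01 borel (\<lambda>t. 2 * pi * t)) A =
        emeasure lborel ({0..<1} \<inter> (\<lambda>t. 2 * pi * t) -` A)"
      using A by (simp add: emeasure_distr divide_ennreal_def)
    also have "{0..<1} \<inter> (\<lambda>t. 2 * pi * t) -` A = (*) (2 * pi) -` ?B \<inter> space lborel"
      by (auto simp: zero_le_mult_iff pi_gt_zero[unfolded not_le[symmetric]])
    also have "emeasure lborel \<dots> = emeasure (distr lborel borel ((*) (2 * pi))) ?B"
      by (subst emeasure_distr) auto
    also have "\<dots> = emeasure lborel ?B * ennreal (inverse (2 * pi))"
      by (subst lborel_distr_mult) (auto simp: emeasure_density nn_integral_cmult_indicator mult.commute)
    also have "\<dots> = emeasure (uniform_measure lborel {0..<2 * pi}) A"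
      by (auto simp: divide_ennreal_def inverse_ennreal)
    finally show "emeasure (uniform_measure lborel {0..<2 * pi}) A =
      emeasure (distr unif01 borel (\<lambda>t. 2 * pi * t)) A" ..
  qed simp
  then show ?thesis
    unfolding uniform_circle_def by (simp add: distr_distr comp_def borel_measurable_continuous_onI continuous_intros)
qed

theorem proposition5:
  fixes n :: nat and b :: "nat list set"
  assumes "n \<ge> 3" and "b \<in> realizable_bracelets n"
  shows "bracelet_prob n b \<in> \<rat>"
proof -
  let ?N = "\<Pi>\<^sub>M i\<in>{..<n}. unif01" and ?M = "\<Pi>\<^sub>M i\<in>{..<n}. uniform_circle"
  \<comment> \<open>\<open>compose\<close> is undefined outside the index set, as membership in the
    product space requires.\<close>
  let ?c = "compose {..<n} circ"
  define S where "S = {X \<in> space ?M. bracelet_event n b X}"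
  have prob: "bracelet_prob n b = measure ?M S"
    by (simp add: bracelet_prob_def S_def bracelet_event_def)
  show ?thesis
  proof (cases "S \<in> sets ?M")
    \<comment> \<open>the measure of a non-measurable set is \<open>0\<close> by convention\<close>
    case False
    then show ?thesis by (simp add: prob measure_notin_sets)
  next
    case True
    have circ_borel: "circ \<in> borel_measurable borel"
      by (intro borel_measurable_continuous_onI continuous_intros)
    then have circ: "circ \<in> measurable unif01 uniform_circle"
      by (simp add: uniform_circle_def cong: measurable_cong_sets)
    interpret circle: prob_space uniform_circle
      unfolding uniform_circle_eq using circ_borel
      by (intro prob_space.prob_space_distr prob_space_unif01) (simp cong: measurable_cong_sets)
    \<comment> \<open>The product of push-forwards is the push-forward of the product under the
      coordinatewise map.\<close>
    have M: "?M = distr ?N ?M ?c"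
    proof -
      have "uniform_circle = distr unif01 uniform_circle circ"
        by (subst uniform_circle_eq) (rule distr_cong, simp_all add: uniform_circle_def)
      then show ?thesis
        using distr_PiM_finite_prob_space'[of "{..<n}" "\<lambda>_. unif01" "\<lambda>_. uniform_circle" circ] circ
        by (simp add: prob_space_unif01 circle.prob_space_axioms)
    qed
    have c[measurable]: "?c \<in> measurable ?N ?M"
      unfolding compose_def using circ
      by (intro measurable_restrict measurable_compose[OF measurable_component_singleton])
    \<comment> \<open>The space of \<open>unif01\<close> is the whole line, so the cube is cut out
      explicitly; it has full measure.\<close>
    define D where "D = {x \<in> space ?N. \<forall>i\<in>{..<n}. x i \<in> {0..<1}}"
    define T where "T = marks n \<times> marks n"
    define F where "F x \<longleftrightarrow> ?c x \<in> S" for x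
    have "finite T" by (simp add: T_def finite_marks)
    moreover have "(\<lambda>x. of_bool (case Q of (l, l') \<Rightarrow> l x < l' x)) \<in> rat_pp {..<n}" if "Q \<in> T" for Q
      using that by (auto simp: T_def intro!: rat_pp_less marks_affine)
    moreover have "F y"
      if xy: "x \<in> D" "y \<in> D" and same: "\<And>Q. Q \<in> T \<Longrightarrow>
        (case Q of (l, l') \<Rightarrow> l x < l' x) \<longleftrightarrow> (case Q of (l, l') \<Rightarrow> l y < l' y)" and "F x" for x y
    proof -
      have "l x < l' x \<longleftrightarrow> l y < l' y" if "l \<in> marks n" "l' \<in> marks n" for l l'
        using same[of "(l, l')"] that by (simp add: T_def)
      moreover have "bracelet_event n b (?c x)" using \<open>F x\<close> by (simp add: F_def S_def)
      ultimately have "bracelet_event n b (?c y)"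
        using xy assms(1)
        by (intro bracelet_event_same_marks_order[of n x y "?c x" "?c y" b])
          (simp_all add: D_def compose_def)
      moreover have "?c y \<in> space ?M"
        using xy measurable_space[OF c] by (auto simp: D_def)
      ultimately show "F y" by (simp add: F_def S_def)
    qed
    ultimately obtain G where G: "(\<lambda>x. of_bool (G x)) \<in> rat_pp {..<n}" "\<And>x. x \<in> D \<Longrightarrow> F x \<longleftrightarrow> G x"
      using rat_pp_finitely_determined[of T "\<lambda>Q x. case Q of (l, l') \<Rightarrow> l x < l' x" "{..<n}" D F]
      by blast
    interpret N: prob_space ?N by (rule prob_space_PiM_unif01)
    have V: "?c -` S \<inter> space ?N \<in> sets ?N" using True by measurable
    have "AE x in ?N. x \<in> D"
      using AE_PiM_unif01[of "{..<n}"] by (auto simp: D_def)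
    \<comment> \<open>On the cube the pulled-back event agrees with \<open>G\<close>, so its
      probability is the integral of a function in \<open>rat_pp\<close>.\<close>
    then have "AE x in ?N. indicator (?c -` S \<inter> space ?N) x = (of_bool (G x) :: real)"
      by eventually_elim (auto simp: G(2)[symmetric] F_def indicator_def D_def)
    then have "(\<integral>x. indicator (?c -` S \<inter> space ?N) x \<partial>?N) = (\<integral>x. of_bool (G x) \<partial>?N :: real)"
      using V rat_pp_measurable[OF G(1)] by (intro integral_cong_AE) auto
    then have "measure ?M S = (\<integral>x. of_bool (G x) \<partial>?N)"
      using V True by (subst M) (simp add: measure_distr)
    then show ?thesis
      using rat_pp_integral_Rats[OF _ G(1)] by (simp add: prob)
  qed
qed

end
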